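(* Let $G$ be a subgroup of $\mathcal{S}_3$ and $\lambda\in\mathbb{K}$. Let $(A,\mu,\alpha,R)$ be a Rota-Baxter $G$-Hom-associative algebra of weight $\lambda$ and $\beta\colon A\to A$ be a morphism of Rota-Baxter $G$-Hom-associative algebras. Then $$A_\beta=(A,\mu_\beta=\beta\mu,\beta\alpha,R)$$ is also a Rota-Baxter $G$-Hom-associative algebra of weight $\lambda$. Moreover, if $A$ is multiplicative, then so is $A_\beta$. Furthermore, suppose $(A',\mu',\alpha',R')$ is a Rota-Baxter $G$-Hom-associative algebra of weight $\lambda$ and $\beta'\colon A'\to A'$ is a morphism. If $f\colon A\to A'$ is a morphism such that $f\beta=\beta' f$, then $f\colon A_\beta\to A'_{\beta'}$ is also a morphism, where $A'_{\beta'}=(A',\beta'\mu',\beta'\alpha',R')$.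
   Context: $\mathbb{K}$ is a fixed field of characteristic $0$; all maps are $\mathbb{K}$-linear. A Hom-algebra $(A,\mu,\alpha)$ is a $\mathbb{K}$-module $A$ with a bilinear map $\mu\colon A\times A\to A$ and a linear map $\alpha\colon A\to A$. Its Hom-associator is $\mathfrak{as}_A(x_1,x_2,x_3)=\mu(\mu(x_1,x_2),\alpha(x_3))-\mu(\alpha(x_1),\mu(x_2,x_3))$. It is $G$-Hom-associative if $\sum_{\sigma\in G}(-1)^{\varepsilon(\sigma)}\mathfrak{as}_A(x_{\sigma(1)},x_{\sigma(2)},x_{\sigma(3)})=0$ for all $x_i\in A$, where $(-1)^{\varepsilon(\sigma)}$ is the signature of $\sigma$. A Rota-Baxter $G$-Hom-associative algebra of weight $\lambda$ is $(A,\mu,\alpha,R)$ where $(A,\mu,\alpha)$ is $G$-Hom-associative and $R\colon A\to A$ is linear with $\mu(R(x),R(y))=R(\mu(R(x),y)+\mu(x,R(y))+\lambda\mu(x,y))$ for all $x,y\in A$. It is multiplicative if $\alpha(\mu(x,y))=\mu(\alpha(x),\alpha(y))$ for all $x,y$ and $\alpha R=R\alpha$. A morphism of such algebras is a linear map $f$ with $\mu'\circ(f\otimes f)=f\circ\mu$, $f\circ\alpha=\alpha'\circ f$ and $f\circ R=R'\circ f$. *)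

theory Defs
  imports Complex_Main "HOL-Algebra.Sym_Groups"
begin

text \<open>
  The underlying \<open>'k\<close>-module of an algebra is a whole type \<open>'a\<close> of class \<open>ab_group_add\<close>
  together with an explicit scalar multiplication.
\<close>

record ('k, 'a) hom_alg =
  scal :: "'k \<Rightarrow> 'a \<Rightarrow> 'a"
  prod_map :: "'a \<Rightarrow> 'a \<Rightarrow> 'a"
  twist :: "'a \<Rightarrow> 'a"

record ('k, 'a) rb_hom_alg = "('k, 'a) hom_alg" +
  rb :: "'a \<Rightarrow> 'a"

locale hom_algebra = vector_space "scal A"
  for A :: "('k::field_char_0, 'a::ab_group_add, 'z) hom_alg_scheme" (structure) +
  assumes prod_linear_right: "\<And>x. Vector_Spaces.linear (scal A) (scal A) (\<lambda>y. prod_map A x y)"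
    and prod_linear_left: "\<And>y. Vector_Spaces.linear (scal A) (scal A) (\<lambda>x. prod_map A x y)"
    and twist_linear: "Vector_Spaces.linear (scal A) (scal A) (twist A)"

definition hom_associator ::
    "('k::field_char_0, 'a::ab_group_add, 'z) hom_alg_scheme \<Rightarrow> 'a \<Rightarrow> 'a \<Rightarrow> 'a \<Rightarrow> 'a"
  where "hom_associator A x y z =
    prod_map A (prod_map A x y) (twist A z) - prod_map A (twist A x) (prod_map A y z)"

text \<open>
  \<open>G\<close> is a set of permutations of \<open>{1, 2, 3}\<close>. A triple of elements is a function
  \<open>x :: nat \<Rightarrow> 'a\<close> of which only the values at 1, 2, 3 are used.
\<close>

locale G_hom_assoc_algebra = hom_algebra A
  for G :: "(nat \<Rightarrow> nat) set"
    and A :: "('k::field_char_0, 'a::ab_group_add, 'z) hom_alg_scheme" (structure) +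
  assumes G_hom_assoc:
    "\<And>x :: nat \<Rightarrow> 'a. (\<Sum>\<sigma>\<in>G. scal A (of_int (sign \<sigma>))
        (hom_associator A (x (\<sigma> 1)) (x (\<sigma> 2)) (x (\<sigma> 3)))) = 0"

locale rb_G_hom_assoc_algebra = G_hom_assoc_algebra G A
  for G :: "(nat \<Rightarrow> nat) set" and lam :: "'k::field_char_0"
    and A :: "('k, 'a::ab_group_add, 'z) rb_hom_alg_scheme" (structure) +
  assumes rb_linear: "Vector_Spaces.linear (scal A) (scal A) (rb A)"
    and rota_baxter: "\<And>x y. prod_map A (rb A x) (rb A y) =
      rb A (prod_map A (rb A x) y + prod_map A x (rb A y) + scal A lam (prod_map A x y))"

definition multiplicative ::
    "('k::field_char_0, 'a::ab_group_add, 'z) rb_hom_alg_scheme \<Rightarrow> bool"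
  where "multiplicative A \<longleftrightarrow>
    (\<forall>x y. twist A (prod_map A x y) = prod_map A (twist A x) (twist A y)) \<and>
    twist A \<circ> rb A = rb A \<circ> twist A"

definition rb_morphism ::
    "('k::field_char_0, 'a::ab_group_add, 'y) rb_hom_alg_scheme \<Rightarrow>
     ('k, 'b::ab_group_add, 'z) rb_hom_alg_scheme \<Rightarrow> ('a \<Rightarrow> 'b) \<Rightarrow> bool"
  where "rb_morphism A A' f \<longleftrightarrow>
    Vector_Spaces.linear (scal A) (scal A') f \<and>
    (\<forall>x y. prod_map A' (f x) (f y) = f (prod_map A x y)) \<and>
    f \<circ> twist A = twist A' \<circ> f \<and>
    f \<circ> rb A = rb A' \<circ> f"

definition twist_by ::
    "('k::field_char_0, 'a::ab_group_add) rb_hom_alg \<Rightarrow> ('a \<Rightarrow> 'a) \<Rightarrow> ('k, 'a) rb_hom_alg"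
  where "twist_by A b =
    \<lparr>scal = scal A, prod_map = (\<lambda>x y. b (prod_map A x y)), twist = b \<circ> twist A, rb = rb A\<rparr>"

end

theory Submission
  imports Defs
begin

text \<open>
  Since \<open>\<beta>\<close> commutes with all the structure maps, the Hom-associator of \<open>A\<^sub>\<beta>\<close> is
  \<open>\<beta>\<^sup>2\<close> composed with the Hom-associator of \<open>A\<close>, so linearity of \<open>\<beta>\<close> carries
  the signed sum over \<open>G\<close> along.
\<close>

lemma twist_by_simps [simp]:
  "scal (twist_by A b) = scal A"
  "prod_map (twist_by A b) x y = b (prod_map A x y)"
  "twist (twist_by A b) = b \<circ> twist A"
  "rb (twist_by A b) = rb A"
  by (simp_all add: twist_by_def)

text \<open>The equations are oriented for rewriting: used from left to right they move
  \<open>f\<close> outwards past every structure map.\<close>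

lemma rb_morphismD:
  assumes "rb_morphism A A' f"
  shows "Vector_Spaces.linear (scal A) (scal A') f"
    and "prod_map A' (f x) (f y) = f (prod_map A x y)"
    and "twist A' (f x) = f (twist A x)"
    and "rb A' (f x) = f (rb A x)"
  using assms by (auto simp: rb_morphism_def fun_eq_iff)

text \<open>As the twist is composed with \<open>b\<close> too, both arguments of each outer product
  carry a \<open>b\<close>, which multiplicativity of \<open>b\<close> pulls out; the second
  \<open>b\<close> belongs to the outer product itself.\<close>

lemma hom_associator_twist_by:
  assumes "rb_morphism A A b"
  shows "hom_associator (twist_by A b) x y z = b (b (hom_associator A x y z))"
proof -
  interpret b: Vector_Spaces.linear "scal A" "scal A" b
    by (rule rb_morphismD(1)[OF assms])
  show ?thesis
    by (simp add: hom_associator_def rb_morphismD(2)[OF assms] b.diff)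
qed

lemma rb_G_hom_assoc_algebra_twist_by:
  fixes A :: "('k::field_char_0, 'a::ab_group_add) rb_hom_alg"
  assumes "rb_G_hom_assoc_algebra G lam A" and b: "rb_morphism A A b"
  shows "rb_G_hom_assoc_algebra G lam (twist_by A b)"
proof -
  interpret rb_G_hom_assoc_algebra G lam A by fact
  interpret b: Vector_Spaces.linear "scal A" "scal A" b
    by (rule rb_morphismD(1)[OF b])
  show ?thesis
  proof (intro rb_G_hom_assoc_algebra.intro rb_G_hom_assoc_algebra_axioms.intro
      G_hom_assoc_algebra.intro G_hom_assoc_algebra_axioms.intro
      hom_algebra.intro hom_algebra_axioms.intro)
    fix x y :: 'a
    show "Vector_Spaces.linear (scal (twist_by A b)) (scal (twist_by A b))
        (\<lambda>y. prod_map (twist_by A b) x y)"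
      using Vector_Spaces.linear_compose[OF prod_linear_right b.linear_axioms] by (simp add: o_def)
    show "Vector_Spaces.linear (scal (twist_by A b)) (scal (twist_by A b))
        (\<lambda>x. prod_map (twist_by A b) x y)"
      using Vector_Spaces.linear_compose[OF prod_linear_left b.linear_axioms] by (simp add: o_def)
    show "prod_map (twist_by A b) (rb (twist_by A b) x) (rb (twist_by A b) y) =
      rb (twist_by A b) (prod_map (twist_by A b) (rb (twist_by A b) x) y +
        prod_map (twist_by A b) x (rb (twist_by A b) y) +
        scal (twist_by A b) lam (prod_map (twist_by A b) x y))"
      \<comment> \<open>Linearity, read backwards, gathers the three summands under one
        \<open>b\<close>. This \<open>b\<close> then moves out past \<open>rb A\<close>, leaving
        \<open>b\<close> applied to the identity in \<open>A\<close>.\<close>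
      by (simp add: rota_baxter rb_morphismD(4)[OF b] flip: b.add b.scale)
  next
    fix x :: "nat \<Rightarrow> 'a"
    have "(\<Sum>\<sigma>\<in>G. scal A (of_int (sign \<sigma>))
        (b (b (hom_associator A (x (\<sigma> 1)) (x (\<sigma> 2)) (x (\<sigma> 3)))))) =
      b (b (\<Sum>\<sigma>\<in>G. scal A (of_int (sign \<sigma>))
        (hom_associator A (x (\<sigma> 1)) (x (\<sigma> 2)) (x (\<sigma> 3)))))"
      by (simp add: b.sum b.scale)
    then show "(\<Sum>\<sigma>\<in>G. scal (twist_by A b) (of_int (sign \<sigma>))
        (hom_associator (twist_by A b) (x (\<sigma> 1)) (x (\<sigma> 2)) (x (\<sigma> 3)))) = 0"
      by (simp only: hom_associator_twist_by[OF b] twist_by_simps G_hom_assoc b.zero)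
  \<comment> \<open>What remains is the vector space structure and the linearity of
    \<open>b \<circ> twist A\<close> and of \<open>rb A\<close>; scalars and \<open>rb\<close> are
    the same as in \<open>A\<close>.\<close>
  qed (use Vector_Spaces.linear_compose[OF twist_linear b.linear_axioms] rb_linear
      vector_space_axioms in simp_all)
qed

text \<open>Moving \<open>b\<close> outwards turns both sides of the product condition into
  \<open>b \<circ> b\<close> of the sides for \<open>A\<close>, and both sides of the condition on
  \<open>rb\<close> into \<open>b\<close> of theirs.\<close>

lemma multiplicative_twist_by:
  assumes "rb_morphism A A b" and "multiplicative A"
  shows "multiplicative (twist_by A b)"
  using assms(2) by (simp add: multiplicative_def fun_eq_iff rb_morphismD(2-4)[OF assms(1)])

text \<open>The intertwining relation trades the \<open>b'\<close> in front of the product and twist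
  of \<open>A'\<close> for a \<open>b\<close> inside \<open>f\<close>; linearity and the condition
  on \<open>rb\<close> are inherited unchanged.\<close>

lemma rb_morphism_twist_by:
  assumes f: "rb_morphism A A' f" and "f \<circ> b = b' \<circ> f"
  shows "rb_morphism (twist_by A b) (twist_by A' b') f"
proof -
  have "b' (f x) = f (b x)" for x
    using assms(2) by (simp add: fun_eq_iff)
  then show ?thesis
    using f by (simp add: rb_morphism_def fun_eq_iff) metis
qed

theorem theorem3p9:
  fixes G :: "(nat \<Rightarrow> nat) set"
    and lam :: "'k::field_char_0"
    and A :: "('k, 'a::ab_group_add) rb_hom_alg"
    and \<beta> :: "'a \<Rightarrow> 'a"
  assumes "subgroup G (sym_group 3)"
    and "rb_G_hom_assoc_algebra G lam A"
    and "rb_morphism A A \<beta>"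
  shows "rb_G_hom_assoc_algebra G lam (twist_by A \<beta>) \<and>
    (multiplicative A \<longrightarrow> multiplicative (twist_by A \<beta>)) \<and>
    (\<forall>(A' :: ('k, 'b::ab_group_add) rb_hom_alg) \<beta>' f.
       rb_G_hom_assoc_algebra G lam A' \<and> rb_morphism A' A' \<beta>' \<and>
       rb_morphism A A' f \<and> f \<circ> \<beta> = \<beta>' \<circ> f \<longrightarrow>
       rb_morphism (twist_by A \<beta>) (twist_by A' \<beta>') f)"
  using rb_G_hom_assoc_algebra_twist_by[OF assms(2,3)] multiplicative_twist_by[OF assms(3)]
  by (blast intro: rb_morphism_twist_by)

end
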